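(* Let $(X,d)$ be an arbitrary metric space. The function $d_*:J(X)\times J(X)\to[0,\infty)$, $$d_*(x,y)=\int_{-\infty}^{\infty}d^\times(r^+x,r^+y)\,\frac{e^{-|r|}}{2}\,dr,$$ is a well-defined $\mathrm{Isom}(X)$-invariant metric on the symmetric join $J(X)$, independent of the choice of the basepoint $x_0$.
   Context: Let $(X,d)$ be a metric space and fix a basepoint $x_0\in X$. For points of $X$ put $\langle a,a'|b,b'\rangle=\frac12(d(a,b)-d(a',b)-d(a,b')+d(a',b'))$, $\langle a|b\rangle_c=\frac12(d(a,c)+d(b,c)-d(a,b))$, $\langle a,a'|u\rangle=\langle a,a'|u,x_0\rangle$. $\mathrm{Isom}(X)$ is the isometry group. Symmetric join. For $a,b\in X$ let $\alpha=-\langle b|x_0\rangle_a$, $\beta=\langle a|x_0\rangle_b$; the line $[\![a,b]\!]$ is a copy of $[\alpha,\beta]\subseteq\mathbb R$ (of length $d(a,b)$), and $[\![a,b;s]\!]$ is its point with coordinate $s\in[\alpha,\beta]$. $J(X)$ is the disjoint union of all lines $[\![a,b]\!]$, $(a,b)\in X^2$, with the left endpoint of $[\![a,b]\!]$ identified with the point $[\![a,a]\!]$ and the right endpoint with $[\![b,b]\!]$; $X\subseteq J(X)$ via $a\mapsto[\![a,a]\!]$. For another basepoint $x_1$ the lines are identified by the orientation-preserving isometry, $[\![a,b;t]\!]_{x_1}=[\![a,b;t+\langle a,b|x_1,x_0\rangle]\!]_{x_0}$. Let $\theta[\alpha,\beta;t]=\min(\max(t,\alpha),\beta)$, $\theta'[\alpha,\beta;t]=\int_{-\infty}^\infty\theta[\alpha,\beta;r+t]\frac{e^{-|r|}}2dr$,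 and $[\![a,b;t]\!]':=[\![a,b;\theta'[\alpha,\beta;t]]\!]$ for $t\in[-\infty,\infty]$; for $a\ne b$ this is a homeomorphism $[-\infty,\infty]\to[\![a,b]\!]$. $\mathbb R$ acts on $J(X)$ by $r^+[\![a,b;t]\!]'=[\![a,b;r+t]\!]'$; $\mathrm{Isom}(X)$ acts by $g[\![a,b;s]\!]=[\![ga,gb;s+\langle a,b|x_0,g^{-1}x_0\rangle]\!]$. For $u\in X$, $x=[\![a,a';s]\!]\in J(X)$: $\ell(u,x)=\langle a|a'\rangle_u+|s-\langle a,a'|u\rangle|$; $\beta^\times_u(x,y)=\ell(u,x)-\ell(u,y)$; $d^\times(x,y)=\sup_{u\in X}|\beta^\times_u(x,y)|$, a pseudometric on $J(X)$. *)

theory Defs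
  imports "HOL-Analysis.Analysis"
begin

definition double_diff :: "'a::metric_space \<Rightarrow> 'a \<Rightarrow> 'a \<Rightarrow> 'a \<Rightarrow> real"
  where "double_diff a a' b b' = (dist a b - dist a' b - dist a b' + dist a' b') / 2"

definition gromov_prod :: "'a::metric_space \<Rightarrow> 'a \<Rightarrow> 'a \<Rightarrow> real"
  where "gromov_prod a b c = (dist a c + dist b c - dist a b) / 2"

text \<open>
  Notions that depend on the basepoint take it as their first argument. A point of the line from
  \<open>a\<close> to \<open>b\<close> is a triple consisting of \<open>a\<close>, \<open>b\<close> and its coordinate with respect to the basepoint;
  the join is the quotient of the set of these triples by the equivalence relation that the
  identifications of the endpoints generate.
\<close>

definition line_left :: "'a::metric_space \<Rightarrow> 'a \<Rightarrow> 'a \<Rightarrow> real"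
  where "line_left x0 a b = - gromov_prod b x0 a"

definition line_right :: "'a::metric_space \<Rightarrow> 'a \<Rightarrow> 'a \<Rightarrow> real"
  where "line_right x0 a b = gromov_prod a x0 b"

definition line_points :: "'a::metric_space \<Rightarrow> ('a \<times> 'a \<times> real) set"
  where "line_points x0 = {(a, b, s). line_left x0 a b \<le> s \<and> s \<le> line_right x0 a b}"

text \<open>The line from \<open>a\<close> to \<open>a\<close> consists of the single point with coordinate \<open>0\<close>.\<close>

inductive glue :: "'a::metric_space \<Rightarrow> 'a \<times> 'a \<times> real \<Rightarrow> 'a \<times> 'a \<times> real \<Rightarrow> bool"
  for x0 :: 'a where
  left: "glue x0 (a, b, line_left x0 a b) (a, a, 0)"
| right: "glue x0 (a, b, line_right x0 a b) (b, b, 0)"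

definition join_rel :: "'a::metric_space \<Rightarrow> (('a \<times> 'a \<times> real) \<times> ('a \<times> 'a \<times> real)) set"
  where "join_rel x0 = {(p, q). p \<in> line_points x0 \<and> q \<in> line_points x0 \<and> equivclp (glue x0) p q}"

definition sym_join :: "'a::metric_space \<Rightarrow> ('a \<times> 'a \<times> real) set set"
  where "sym_join x0 = line_points x0 // join_rel x0"

definition join_pt :: "'a::metric_space \<Rightarrow> 'a \<Rightarrow> 'a \<Rightarrow> real \<Rightarrow> ('a \<times> 'a \<times> real) set"
  where "join_pt x0 a b s = join_rel x0 `` {(a, b, s)}"

text \<open>
  In the following, \<^const>\<open>the_elem\<close> extracts the common value of a function on all
  representatives of a point of the join.
\<close>

definition change_base :: "'a::metric_space \<Rightarrow> 'a \<Rightarrow> ('a \<times> 'a \<times> real) set \<Rightarrow> ('a \<times> 'a \<times> real) set"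
  where "change_base x1 x0 x =
    the_elem ((\<lambda>(a, b, t). join_pt x0 a b (t + double_diff a b x1 x0)) ` x)"

definition Isom :: "('a::metric_space \<Rightarrow> 'a) set"
  where "Isom = {g. bij g \<and> (\<forall>x y. dist (g x) (g y) = dist x y)}"

definition isom_act ::
    "'a::metric_space \<Rightarrow> ('a \<Rightarrow> 'a) \<Rightarrow> ('a \<times> 'a \<times> real) set \<Rightarrow> ('a \<times> 'a \<times> real) set"
  where "isom_act x0 g x =
    the_elem ((\<lambda>(a, b, s). join_pt x0 (g a) (g b) (s + double_diff a b x0 (inv g x0))) ` x)"

definition clamp_ereal :: "real \<Rightarrow> real \<Rightarrow> ereal \<Rightarrow> real"
  where "clamp_ereal \<alpha> \<beta> t = real_of_ereal (min (max t (ereal \<alpha>)) (ereal \<beta>))"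

definition smooth_clamp :: "real \<Rightarrow> real \<Rightarrow> ereal \<Rightarrow> real"
  where "smooth_clamp \<alpha> \<beta> t =
    (\<integral>r. clamp_ereal \<alpha> \<beta> (ereal r + t) * (exp (- \<bar>r\<bar>) / 2) \<partial>lborel)"

definition smooth_pt :: "'a::metric_space \<Rightarrow> 'a \<Rightarrow> 'a \<Rightarrow> ereal \<Rightarrow> ('a \<times> 'a \<times> real) set"
  where "smooth_pt x0 a b t =
    join_pt x0 a b (smooth_clamp (line_left x0 a b) (line_right x0 a b) t)"

text \<open>
  A point may have several coordinates \<open>t\<close>: the endpoints are \<open>t = \<plusminus>\<infinity>\<close>, on every line that ends there,
  and if \<open>a = b\<close> then \<open>t\<close> is arbitrary. The shifted point is the same for all of them.
\<close>

definition flow :: "'a::metric_space \<Rightarrow> real \<Rightarrow> ('a \<times> 'a \<times> real) set \<Rightarrow> ('a \<times> 'a \<times> real) set"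
  where "flow x0 r x =
    the_elem {smooth_pt x0 a b (ereal r + t) | a b t. x = smooth_pt x0 a b t}"

definition ell :: "'a::metric_space \<Rightarrow> 'a \<Rightarrow> ('a \<times> 'a \<times> real) set \<Rightarrow> real"
  where "ell x0 u x =
    the_elem ((\<lambda>(a, a', s). gromov_prod a a' u + \<bar>s - double_diff a a' u x0\<bar>) ` x)"

definition busemann_cross ::
    "'a::metric_space \<Rightarrow> 'a \<Rightarrow> ('a \<times> 'a \<times> real) set \<Rightarrow> ('a \<times> 'a \<times> real) set \<Rightarrow> real"
  where "busemann_cross x0 u x y = ell x0 u x - ell x0 u y"

definition dist_cross ::
    "'a::metric_space \<Rightarrow> ('a \<times> 'a \<times> real) set \<Rightarrow> ('a \<times> 'a \<times> real) set \<Rightarrow> real"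
  where "dist_cross x0 x y = (SUP u. \<bar>busemann_cross x0 u x y\<bar>)"

text \<open>
  The locale \<^locale>\<open>Metric_space\<close> asks for nonnegativity and symmetry on the whole type, hence
  the value \<open>0\<close> outside the join.
\<close>

definition dist_star ::
    "'a::metric_space \<Rightarrow> ('a \<times> 'a \<times> real) set \<Rightarrow> ('a \<times> 'a \<times> real) set \<Rightarrow> real"
  where "dist_star x0 x y =
    (if x \<in> sym_join x0 \<and> y \<in> sym_join x0
     then \<integral>r. dist_cross x0 (flow x0 r x) (flow x0 r y) * (exp (- \<bar>r\<bar>) / 2) \<partial>lborel
     else 0)"

lemmas products = double_diff_def gromov_prod_def line_left_def line_right_def

lemma line_length: "line_right x0 a b - line_left x0 a b = dist a b"
  by (simp add: products dist_commute field_simps)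

lemma line_left_le_right: "line_left x0 a b \<le> line_right x0 a b"
  using line_length[of x0 a b] zero_le_dist[of a b] by linarith

lemma line_refl [simp]: "line_left x0 a a = 0" "line_right x0 a a = 0"
  by (simp_all add: products dist_commute)

lemma equiv_join_rel: "equiv (line_points x0) (join_rel x0)"
proof (rule equivI)
  show "join_rel x0 \<subseteq> line_points x0 \<times> line_points x0"
    by (auto simp: join_rel_def)
  show "refl_on (line_points x0) (join_rel x0)"
    by (auto simp: refl_on_def join_rel_def)
  show "sym (join_rel x0)"
    by (auto simp: sym_def join_rel_def intro: equivclp_sym)
  show "trans (join_rel x0)"
    by (auto simp: trans_def join_rel_def intro: equivclp_trans)
qed

lemma sym_join_cases:
  assumes "x \<in> sym_join x0"
  obtains a b s where "x = join_pt x0 a b s" "line_left x0 a b \<le> s" "s \<le> line_right x0 a b"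
  using assms by (auto simp: sym_join_def quotient_def join_pt_def line_points_def)

lemma join_pt_in_sym_join:
  "line_left x0 a b \<le> s \<Longrightarrow> s \<le> line_right x0 a b \<Longrightarrow> join_pt x0 a b s \<in> sym_join x0"
  by (auto simp: sym_join_def quotient_def join_pt_def line_points_def)

lemma join_pt_left: "join_pt x0 a b (line_left x0 a b) = join_pt x0 a a 0"
  unfolding join_pt_def
  by (rule equiv_class_eq[OF equiv_join_rel])
    (auto simp: join_rel_def line_points_def line_left_le_right intro: glue.left)

lemma join_pt_right: "join_pt x0 a b (line_right x0 a b) = join_pt x0 b b 0"
  unfolding join_pt_def
  by (rule equiv_class_eq[OF equiv_join_rel])
    (auto simp: join_rel_def line_points_def line_left_le_right intro: glue.right)

lemma the_elem_join_pt:
  assumes s: "line_left x0 a b \<le> s" "s \<le> line_right x0 a b"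
    and f: "\<And>p q. glue x0 p q \<Longrightarrow> f p = f q"
  shows "the_elem (f ` join_pt x0 a b s) = f (a, b, s)"
proof -
  have eq: "f p = f q" if "equivclp (glue x0) p q" for p q
    using that by (induction rule: equivclp_induct) (auto dest: f)
  have "join_pt x0 a b s \<noteq> {}"
    using s equiv_class_self[OF equiv_join_rel, of "(a, b, s)" x0]
    by (auto simp: join_pt_def line_points_def)
  moreover have "f q = f (a, b, s)" if "q \<in> join_pt x0 a b s" for q
    using that eq[of "(a, b, s)" q] by (auto simp: join_pt_def join_rel_def)
  ultimately show ?thesis by (rule the_elem_image_unique)
qed

lemma ell_join_pt:
  assumes "line_left x0 a b \<le> s" "s \<le> line_right x0 a b"
  shows "ell x0 u (join_pt x0 a b s) = gromov_prod a b u + \<bar>s - double_diff a b u x0\<bar>"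
proof -
  have L: "\<bar>line_left x0 a b - double_diff a b u x0\<bar> = gromov_prod b u a" for a b
    using dist_triangle[of b u a] by (simp add: products dist_commute field_simps)
  have R: "\<bar>line_right x0 a b - double_diff a b u x0\<bar> = gromov_prod a u b" for a b
    using dist_triangle[of a u b] by (simp add: products dist_commute field_simps)
  have "(case p of (a, a', s) \<Rightarrow> gromov_prod a a' u + \<bar>s - double_diff a a' u x0\<bar>) =
      (case q of (a, a', s) \<Rightarrow> gromov_prod a a' u + \<bar>s - double_diff a a' u x0\<bar>)"
    if "glue x0 p q" for p q
    using that by cases (simp_all add: L R, simp_all add: products dist_commute field_simps)
  from the_elem_join_pt[OF assms this] show ?thesis
    by (simp add: ell_def)
qed

lemma change_base_join_pt:
  assumes "line_left x1 a b \<le> s" "s \<le> line_right x1 a b"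
  shows "change_base x1 x0 (join_pt x1 a b s) = join_pt x0 a b (s + double_diff a b x1 x0)"
proof -
  have L: "line_left x1 a b + double_diff a b x1 x0 = line_left x0 a b" for a b
    by (simp add: products dist_commute field_simps)
  have R: "line_right x1 a b + double_diff a b x1 x0 = line_right x0 a b" for a b
    by (simp add: products dist_commute field_simps)
  have Z: "double_diff a a x1 x0 = 0" for a
    by (simp add: products)
  have "(case p of (a, b, t) \<Rightarrow> join_pt x0 a b (t + double_diff a b x1 x0)) =
      (case q of (a, b, t) \<Rightarrow> join_pt x0 a b (t + double_diff a b x1 x0))"
    if "glue x1 p q" for p q
    using that by cases (simp_all add: L R Z join_pt_left join_pt_right)
  from the_elem_join_pt[OF assms this] show ?thesis
    by (simp add: change_base_def)
qed

lemma isom_act_join_pt: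
  assumes g: "g \<in> Isom" and s: "line_left x0 a b \<le> s" "s \<le> line_right x0 a b"
  shows "isom_act x0 g (join_pt x0 a b s) =
    join_pt x0 (g a) (g b) (s + double_diff a b x0 (inv g x0))"
proof -
  have d: "dist (g x) (g y) = dist x y" for x y
    using g by (simp add: Isom_def)
  have d': "dist (g x) x0 = dist x (inv g x0)" for x
    using g d[of x "inv g x0"] by (simp add: Isom_def bij_is_surj surj_f_inv_f)
  have L: "line_left x0 a b + double_diff a b x0 (inv g x0) = line_left x0 (g a) (g b)" for a b
    using d'[of a] d'[of b] by (simp add: products d dist_commute field_simps)
  have R: "line_right x0 a b + double_diff a b x0 (inv g x0) = line_right x0 (g a) (g b)" for a b
    using d'[of a] d'[of b] by (simp add: products d dist_commute field_simps)
  have Z: "double_diff a a x0 (inv g x0) = 0" for a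
    by (simp add: products)
  have "(case p of (a, b, s) \<Rightarrow> join_pt x0 (g a) (g b) (s + double_diff a b x0 (inv g x0))) =
      (case q of (a, b, s) \<Rightarrow> join_pt x0 (g a) (g b) (s + double_diff a b x0 (inv g x0)))"
    if "glue x0 p q" for p q
    using that by cases (simp_all add: L R Z join_pt_left join_pt_right)
  from the_elem_join_pt[OF s this] show ?thesis
    by (simp add: isom_act_def)
qed

end

theory Submission
  imports Defs "HOL-Probability.Sinc_Integral"
begin

text \<open>
  Every point of the join is \<open>[[a, b; t]]'\<close> with \<open>t\<close> real (endpoints lie on constant lines), and the
  flow translates \<open>t\<close>. Since the smoothed clamp is \<open>1\<close>-Lipschitz, \<open>d\<^sup>\<times>(r\<^sup>+x, r\<^sup>+y)\<close> is a bounded Lipschitz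
  function of \<open>r\<close>, hence integrable against the Laplace density, and if the integral vanishes then it
  vanishes for every \<open>r\<close>. Letting \<open>r\<close> tend to \<open>-\<infinity>\<close> and \<open>\<infinity>\<close> then shows that \<open>x\<close> and \<open>y\<close> lie on the
  same line \<open>[[a, b]]\<close>, where \<open>\<ell>(a, -)\<close> is the distance to the left endpoint and separates points.
\<close>

section \<open>Averaging against the Laplace density\<close>

abbreviation (input) laplace :: "real \<Rightarrow> real"
  where "laplace r \<equiv> exp (- \<bar>r\<bar>) / 2"

text \<open>On the half-line this is the Gamma integral with exponent 0, halved; evenness of the
  density doubles it to 1.\<close>

lemma has_bochner_integral_laplace: "has_bochner_integral lborel laplace 1"
proof -
  have "has_bochner_integral lborel (\<lambda>r::real. (r ^ 0 * exp (- r) * indicator {0..} r) / 2) (fact 0 / 2)"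
    by (intro has_bochner_integral_divide_zero has_bochner_integral_I0i_power_exp_m')
  also have "(\<lambda>r::real. (r ^ 0 * exp (- r) * indicator {0..} r) / 2) = (\<lambda>r. indicator {0..} r *\<^sub>R laplace r)"
    by (auto simp: fun_eq_iff split: split_indicator)
  finally have "has_bochner_integral lborel (\<lambda>r. indicator {0..} r *\<^sub>R laplace r) (1 / 2)"
    by simp
  from has_bochner_integral_even_function[OF this] show ?thesis
    by simp
qed

lemma integrable_laplace: "integrable lborel laplace"
  using has_bochner_integral_laplace by (rule integrable.intros)

lemma integral_const_laplace: "(\<integral>r. c * laplace r \<partial>lborel) = c"
  using has_bochner_integral_integral_eq[OF has_bochner_integral_laplace] by simp

lemma integrable_bounded_laplace:
  assumes [measurable]: "f \<in> borel_measurable borel" and le: "\<And>r. \<bar>f r\<bar> \<le> C"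
  shows "integrable lborel (\<lambda>r. f r * laplace r)"
proof (rule Bochner_Integration.integrable_bound)
  show "integrable lborel (\<lambda>r. C * laplace r)"
    using integrable_laplace by (rule integrable_mult_right)
  have "\<bar>f r\<bar> * laplace r \<le> \<bar>C\<bar> * laplace r" for r
    using le[of r] by (intro mult_right_mono) auto
  then show "AE r in lborel. norm (f r * laplace r) \<le> norm (C * laplace r)"
    by (simp add: abs_mult)
qed simp

lemma integral_laplace_mono:
  assumes "integrable lborel (\<lambda>r. f r * laplace r)" "integrable lborel (\<lambda>r. g r * laplace r)"
    and "\<And>r. f r \<le> g r"
  shows "(\<integral>r. f r * laplace r \<partial>lborel) \<le> (\<integral>r. g r * laplace r \<partial>lborel)"
  using assms by (intro integral_mono mult_right_mono) auto

text \<open>The density is positive everywhere, so \<open>f\<close> vanishes almost everywhere. The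
  zero set of \<open>f\<close> is closed with a null open complement, and a nonempty open set is
  never null.\<close>

lemma integral_laplace_eq_0_imp:
  assumes f: "continuous_on UNIV f" "\<And>r. 0 \<le> f r"
    and int: "integrable lborel (\<lambda>r. f r * laplace r)"
    and 0: "(\<integral>r. f r * laplace r \<partial>lborel) = 0"
  shows "f r = 0"
proof -
  have "AE r in lborel. f r * laplace r = 0"
    using integral_nonneg_eq_0_iff_AE[OF int] 0 f(2) by simp
  then have "AE r in lebesgue. r \<in> {r. f r = 0}"
    by (intro AE_completion) auto
  moreover have "closed {r. f r = 0}"
    using f(1) by (intro closed_Collect_eq) auto
  ultimately show ?thesis
    using mem_closed_if_AE_lebesgue by blast
qed

section \<open>The smoothed clamp\<close>

lemma smooth_clamp_real:
  "smooth_clamp \<alpha> \<beta> (ereal t) = (\<integral>r. min (max (r + t) \<alpha>) \<beta> * laplace r \<partial>lborel)"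
proof -
  have "clamp_ereal \<alpha> \<beta> (ereal r + ereal t) = min (max (r + t) \<alpha>) \<beta>" for r
    by (simp add: clamp_ereal_def flip: ereal_max ereal_min)
  then show ?thesis
    by (simp add: smooth_clamp_def)
qed

lemma clamp_PInf: "\<alpha> \<le> \<beta> \<Longrightarrow> clamp_ereal \<alpha> \<beta> (ereal r + \<infinity>) = \<beta>"
  by (simp add: clamp_ereal_def min_def)

lemma clamp_MInf: "\<alpha> \<le> \<beta> \<Longrightarrow> clamp_ereal \<alpha> \<beta> (ereal r + -\<infinity>) = \<alpha>"
  by (simp add: clamp_ereal_def min_def)

lemma smooth_clamp_PInf: "\<alpha> \<le> \<beta> \<Longrightarrow> smooth_clamp \<alpha> \<beta> \<infinity> = \<beta>"
  by (simp only: smooth_clamp_def clamp_PInf integral_const_laplace)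

lemma smooth_clamp_MInf: "\<alpha> \<le> \<beta> \<Longrightarrow> smooth_clamp \<alpha> \<beta> (-\<infinity>) = \<alpha>"
  by (simp only: smooth_clamp_def clamp_MInf integral_const_laplace)

lemma integrable_clamp: "integrable lborel (\<lambda>r. min (max (r + t) \<alpha>) \<beta> * laplace r)"
  \<comment> \<open>The clamp lies between \<alpha> and \<beta>, or is constantly \<beta> if \<beta>
    < \<alpha>; this constant bounds it in both cases.\<close>
  by (rule integrable_bounded_laplace[where C = "\<bar>\<alpha>\<bar> + \<bar>\<beta>\<bar>"]) auto

lemma smooth_clamp_real_bounds:
  assumes "\<alpha> \<le> \<beta>"
  shows "\<alpha> \<le> smooth_clamp \<alpha> \<beta> (ereal t)" "smooth_clamp \<alpha> \<beta> (ereal t) \<le> \<beta>"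
proof -
  have c: "integrable lborel (\<lambda>r. c * laplace r)" for c
    using integrable_laplace by (rule integrable_mult_right)
  show "\<alpha> \<le> smooth_clamp \<alpha> \<beta> (ereal t)"
    using integral_laplace_mono[OF c integrable_clamp, of \<alpha> t \<alpha> \<beta>] assms
    unfolding integral_const_laplace smooth_clamp_real by auto
  show "smooth_clamp \<alpha> \<beta> (ereal t) \<le> \<beta>"
    using integral_laplace_mono[OF integrable_clamp c, of t \<alpha> \<beta> \<beta>] assms
    unfolding integral_const_laplace smooth_clamp_real by auto
qed

lemma smooth_clamp_bounds:
  assumes "\<alpha> \<le> \<beta>"
  shows "\<alpha> \<le> smooth_clamp \<alpha> \<beta> t" "smooth_clamp \<alpha> \<beta> t \<le> \<beta>"
  using assms smooth_clamp_real_bounds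
  by (cases t; simp add: smooth_clamp_PInf smooth_clamp_MInf)+

text \<open>For each r the clamp of r + t is 1-Lipschitz in t, and averaging against a probability
  density preserves this.\<close>

lemma smooth_clamp_lipschitz:
  "\<bar>smooth_clamp \<alpha> \<beta> (ereal t) - smooth_clamp \<alpha> \<beta> (ereal t')\<bar> \<le> \<bar>t - t'\<bar>"
proof -
  have "smooth_clamp \<alpha> \<beta> (ereal t) \<le> smooth_clamp \<alpha> \<beta> (ereal t') + \<bar>t - t'\<bar>" for t t'
  proof -
    have c: "integrable lborel (\<lambda>r. \<bar>t - t'\<bar> * laplace r)"
      using integrable_laplace by (rule integrable_mult_right)
    have i: "integrable lborel (\<lambda>r. (min (max (r + t') \<alpha>) \<beta> + \<bar>t - t'\<bar>) * laplace r)"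
      using Bochner_Integration.integrable_add[OF integrable_clamp c] by (simp only: distrib_right)
    have "(\<integral>r. min (max (r + t) \<alpha>) \<beta> * laplace r \<partial>lborel) \<le>
        (\<integral>r. (min (max (r + t') \<alpha>) \<beta> + \<bar>t - t'\<bar>) * laplace r \<partial>lborel)"
      by (rule integral_laplace_mono[OF integrable_clamp i]) linarith
    also have "\<dots> = (\<integral>r. min (max (r + t') \<alpha>) \<beta> * laplace r \<partial>lborel) + \<bar>t - t'\<bar>"
      by (simp only: distrib_right Bochner_Integration.integral_add[OF integrable_clamp c]
          integral_const_laplace)
    finally show ?thesis
      by (simp only: smooth_clamp_real)
  qed
  from this[of t t'] this[of t' t] show ?thesis
    by linarith
qed

lemma continuous_smooth_clamp: "continuous_on UNIV (\<lambda>t. smooth_clamp \<alpha> \<beta> (ereal t))"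
  by (rule lipschitz_on_continuous_on[where L = 1])
    (auto simp: lipschitz_on_def dist_real_def intro: smooth_clamp_lipschitz)

text \<open>A change of the basepoint or an isometry shifts both ends of a line by the same
  \<delta>. By this identity it also acts on the smoothed parameter as translation by \<delta>,
  which commutes with the flow.\<close>

lemma smooth_clamp_translate:
  "smooth_clamp (\<alpha> + \<delta>) (\<beta> + \<delta>) (ereal (t + \<delta>)) = smooth_clamp \<alpha> \<beta> (ereal t) + \<delta>"
proof -
  have c: "integrable lborel (\<lambda>r. \<delta> * laplace r)"
    using integrable_laplace by (rule integrable_mult_right)
  have "min (max (r + (t + \<delta>)) (\<alpha> + \<delta>)) (\<beta> + \<delta>) = min (max (r + t) \<alpha>) \<beta> + \<delta>" for r
    by linarith
  then show ?thesis
    by (simp only: smooth_clamp_real distrib_right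
        Bochner_Integration.integral_add[OF integrable_clamp c] integral_const_laplace)
qed

lemma smooth_clamp_strict_mono:
  assumes "\<alpha> < \<beta>" "t < t'"
  shows "smooth_clamp \<alpha> \<beta> (ereal t) < smooth_clamp \<alpha> \<beta> (ereal t')"
proof -
  let ?c = "\<lambda>t r. min (max (r + t) \<alpha>) \<beta>"
  let ?D = "\<lambda>r. ?c t' r - ?c t r"
  have D: "(\<integral>r. ?D r * laplace r \<partial>lborel) = smooth_clamp \<alpha> \<beta> (ereal t') - smooth_clamp \<alpha> \<beta> (ereal t)"
    by (simp only: smooth_clamp_real left_diff_distrib
        Bochner_Integration.integral_diff[OF integrable_clamp integrable_clamp])
  have i: "integrable lborel (\<lambda>r. ?D r * laplace r)"
    using Bochner_Integration.integrable_diff[OF integrable_clamp integrable_clamp]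
    by (simp only: left_diff_distrib)
  have D0: "0 \<le> ?D r" for r
    using assms by linarith
  \<comment> \<open>At \<open>r = \<alpha> - t\<close> the clamp for t is just leaving the value
    \<alpha>, while the clamp for t' is already above it. By continuity one such r forces a nonzero
    integral.\<close>
  have "?D (\<alpha> - t) \<noteq> 0"
    using assms by linarith
  moreover have "continuous_on UNIV ?D"
    by (intro continuous_intros)
  ultimately have "(\<integral>r. ?D r * laplace r \<partial>lborel) \<noteq> 0"
    using integral_laplace_eq_0_imp[of ?D, OF _ D0 i] by blast
  moreover have "(\<integral>r. ?D r * laplace r \<partial>lborel) \<ge> 0"
    using D0 by (intro Bochner_Integration.integral_nonneg) simp
  ultimately show ?thesis
    using D by linarith
qed

text \<open>Strict monotonicity against the parameters t - 1 and t + 1, where the weak bounds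
  hold.\<close>

lemma smooth_clamp_interior:
  assumes "\<alpha> < \<beta>"
  shows "\<alpha> < smooth_clamp \<alpha> \<beta> (ereal t)" "smooth_clamp \<alpha> \<beta> (ereal t) < \<beta>"
  using smooth_clamp_strict_mono[OF assms, of "t - 1" t] smooth_clamp_strict_mono[OF assms, of t "t + 1"]
    smooth_clamp_real_bounds(1)[of \<alpha> \<beta> "t - 1"] smooth_clamp_real_bounds(2)[of \<alpha> \<beta> "t + 1"] assms
  by simp_all

text \<open>Real parameters give interior values, so \<alpha> and \<beta> are attained only at the
  infinite parameters; on the reals strict monotonicity decides.\<close>

lemma smooth_clamp_inj:
  assumes "\<alpha> < \<beta>" "smooth_clamp \<alpha> \<beta> t = smooth_clamp \<alpha> \<beta> t'"
  shows "t = t'"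
proof -
  have int: "smooth_clamp \<alpha> \<beta> (ereal r) \<noteq> \<alpha>" "smooth_clamp \<alpha> \<beta> (ereal r) \<noteq> \<beta>" for r
    using smooth_clamp_interior[OF assms(1), of r] by simp_all
  have real: "smooth_clamp \<alpha> \<beta> (ereal r) = smooth_clamp \<alpha> \<beta> (ereal r') \<longleftrightarrow> r = r'" for r r'
    using smooth_clamp_strict_mono[OF assms(1), of r r'] smooth_clamp_strict_mono[OF assms(1), of r' r]
    by (cases r r' rule: linorder_cases) auto
  show ?thesis
    using assms
    by (cases t; cases t'; simp add: smooth_clamp_PInf smooth_clamp_MInf real int int[symmetric])
qed

text \<open>Dominated convergence: for each fixed r the integrand is eventually constant in
  n.\<close>

lemma smooth_clamp_tendsto:
  assumes ev: "\<And>r. eventually (\<lambda>n. min (max (r + X n) \<alpha>) \<beta> = c) sequentially"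
  shows "(\<lambda>n. smooth_clamp \<alpha> \<beta> (ereal (X n))) \<longlonglongrightarrow> c"
proof -
  have "(\<lambda>n. \<integral>r. min (max (r + X n) \<alpha>) \<beta> * laplace r \<partial>lborel) \<longlonglongrightarrow> (\<integral>r. c * laplace r \<partial>lborel)"
  proof (rule integral_dominated_convergence[where w = "\<lambda>r. (\<bar>\<alpha>\<bar> + \<bar>\<beta>\<bar>) * laplace r"])
    show "integrable lborel (\<lambda>r. (\<bar>\<alpha>\<bar> + \<bar>\<beta>\<bar>) * laplace r)"
      using integrable_laplace by (rule integrable_mult_right)
    have "(\<lambda>n. min (max (r + X n) \<alpha>) \<beta> * laplace r) \<longlonglongrightarrow> c * laplace r" for r
      using ev[of r] by (intro tendsto_mult tendsto_const tendsto_eventually)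
    then show "AE r in lborel. (\<lambda>n. min (max (r + X n) \<alpha>) \<beta> * laplace r) \<longlonglongrightarrow> c * laplace r"
      by simp
    have "\<bar>min (max (r + X n) \<alpha>) \<beta>\<bar> * laplace r \<le> (\<bar>\<alpha>\<bar> + \<bar>\<beta>\<bar>) * laplace r" for n r
      by (intro mult_right_mono) auto
    then show "AE r in lborel. norm (min (max (r + X n) \<alpha>) \<beta> * laplace r) \<le> (\<bar>\<alpha>\<bar> + \<bar>\<beta>\<bar>) * laplace r" for n
      by (simp add: abs_mult)
  qed simp_all
  then show ?thesis
    by (simp only: smooth_clamp_real integral_const_laplace)
qed

lemma smooth_clamp_at_top:
  assumes "\<alpha> \<le> \<beta>"
  shows "(\<lambda>n. smooth_clamp \<alpha> \<beta> (ereal (real n + t))) \<longlonglongrightarrow> \<beta>"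
proof (rule smooth_clamp_tendsto)
  fix r
  have "eventually (\<lambda>n. real n \<ge> \<beta> - t - r) sequentially"
    using filterlim_real_sequentially by (simp add: filterlim_at_top)
  then show "eventually (\<lambda>n. min (max (r + (real n + t)) \<alpha>) \<beta> = \<beta>) sequentially"
    by eventually_elim (use assms in linarith)
qed

lemma smooth_clamp_at_bot:
  assumes "\<alpha> \<le> \<beta>"
  shows "(\<lambda>n. smooth_clamp \<alpha> \<beta> (ereal (- real n + t))) \<longlonglongrightarrow> \<alpha>"
proof (rule smooth_clamp_tendsto)
  fix r
  have "eventually (\<lambda>n. real n \<ge> r + t - \<alpha>) sequentially"
    using filterlim_real_sequentially by (simp add: filterlim_at_top)
  then show "eventually (\<lambda>n. min (max (r + (- real n + t)) \<alpha>) \<beta> = \<alpha>) sequentially"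
    by eventually_elim (use assms in linarith)
qed

lemma smooth_clamp_surj:
  assumes "\<alpha> < s" "s < \<beta>"
  obtains t where "smooth_clamp \<alpha> \<beta> (ereal t) = s"
proof -
  \<comment> \<open>The summand 0 is the offset t of the limit lemma. Values below and above s are
    found this way, and the intermediate value theorem gives s.\<close>
  have "eventually (\<lambda>n. smooth_clamp \<alpha> \<beta> (ereal (- real n + 0)) < s) sequentially"
    using assms by (intro order_tendstoD(2)[OF smooth_clamp_at_bot]) auto
  then obtain m where m: "smooth_clamp \<alpha> \<beta> (ereal (- real m)) < s"
    using eventually_happens'[OF sequentially_bot] by auto
  have "eventually (\<lambda>n. s < smooth_clamp \<alpha> \<beta> (ereal (real n + 0))) sequentially"
    using assms by (intro order_tendstoD(1)[OF smooth_clamp_at_top]) auto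
  then obtain n where n: "s < smooth_clamp \<alpha> \<beta> (ereal (real n))"
    using eventually_happens'[OF sequentially_bot] by auto
  have "\<exists>t\<ge>- real m. t \<le> real n \<and> smooth_clamp \<alpha> \<beta> (ereal t) = s"
    using m n by (intro IVT' continuous_on_subset[OF continuous_smooth_clamp]) auto
  then show ?thesis
    using that by blast
qed

section \<open>Points of the join and the flow\<close>

lemma smooth_line_bounds:
  "line_left x0 a b \<le> smooth_clamp (line_left x0 a b) (line_right x0 a b) t"
  "smooth_clamp (line_left x0 a b) (line_right x0 a b) t \<le> line_right x0 a b"
  by (rule smooth_clamp_bounds[OF line_left_le_right])+

lemma smooth_pt_in_sym_join: "smooth_pt x0 a b t \<in> sym_join x0"
  unfolding smooth_pt_def by (intro join_pt_in_sym_join smooth_line_bounds)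

lemma smooth_pt_refl: "smooth_pt x0 a a t = join_pt x0 a a 0"
  using smooth_line_bounds[of x0 a a t] by (simp add: smooth_pt_def)

lemma smooth_pt_PInf: "smooth_pt x0 a b \<infinity> = join_pt x0 b b 0"
  by (simp add: smooth_pt_def smooth_clamp_PInf line_left_le_right join_pt_right)

lemma smooth_pt_MInf: "smooth_pt x0 a b (-\<infinity>) = join_pt x0 a a 0"
  by (simp add: smooth_pt_def smooth_clamp_MInf line_left_le_right join_pt_left)

lemma line_left_less_right: "a \<noteq> b \<Longrightarrow> line_left x0 a b < line_right x0 a b"
  using line_length[of x0 a b] zero_less_dist_iff[of a b] by linarith

lemma sym_join_smooth_cases:
  assumes "x \<in> sym_join x0"
  obtains a b t where "x = smooth_pt x0 a b (ereal t)"
proof -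
  obtain a b s where x: "x = join_pt x0 a b s" and s: "line_left x0 a b \<le> s" "s \<le> line_right x0 a b"
    using assms by (rule sym_join_cases)
  consider "s = line_left x0 a b" | "s = line_right x0 a b" | "line_left x0 a b < s" "s < line_right x0 a b"
    using s by linarith
  then show ?thesis
  proof cases
    \<comment> \<open>An end of a line is also the only point of a constant line, where every
      parameter describes it; the real parameter 0 replaces an infinite one.\<close>
    case 1
    then show ?thesis
      using that[of a a 0] x by (simp add: smooth_pt_refl join_pt_left)
  next
    case 2
    then show ?thesis
      using that[of b b 0] x by (simp add: smooth_pt_refl join_pt_right)
  next
    case 3
    then obtain t where "smooth_clamp (line_left x0 a b) (line_right x0 a b) (ereal t) = s"
      by (rule smooth_clamp_surj)
    then show ?thesis
      using that[of a b t] x by (simp add: smooth_pt_def)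
  qed
qed

section \<open>Normal forms and well-definedness of the flow\<close>

text \<open>A function constant exactly on the classes of the join, so distinct points can be told apart.\<close>

definition normal_form :: "'a::metric_space \<Rightarrow> 'a \<times> 'a \<times> real \<Rightarrow> 'a + 'a \<times> 'a \<times> real"
  where "normal_form x0 = (\<lambda>(a, b, s).
    if s = line_left x0 a b then Inl a else if s = line_right x0 a b then Inl b else Inr (a, b, s))"

lemma normal_form_glue: "glue x0 p q \<Longrightarrow> normal_form x0 p = normal_form x0 q"
proof (induction rule: glue.induct)
  \<comment> \<open>If a = b the two ends coincide and the first branch already returns b; otherwise
    the ends differ and the second branch applies.\<close>
  case (right a b)
  then show ?case
    using line_left_less_right[of a b x0] by (cases "a = b") (auto simp: normal_form_def)
qed (auto simp: normal_form_def)

text \<open>Since \<open>normal_form\<close> respects the gluing, it descends to the join and can be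
  read off from the class.\<close>

lemma join_pt_eqD:
  assumes "join_pt x0 a b s = join_pt x0 a' b' s'"
    and s: "line_left x0 a b \<le> s" "s \<le> line_right x0 a b"
    and s': "line_left x0 a' b' \<le> s'" "s' \<le> line_right x0 a' b'"
  shows "normal_form x0 (a, b, s) = normal_form x0 (a', b', s')"
  using the_elem_join_pt[OF s, of "normal_form x0", OF normal_form_glue]
    the_elem_join_pt[OF s', of "normal_form x0", OF normal_form_glue] assms(1)
  by simp

lemma normal_form_smooth:
  "normal_form x0 (a, b, smooth_clamp (line_left x0 a b) (line_right x0 a b) t) =
    (if a = b \<or> t = -\<infinity> then Inl a else if t = \<infinity> then Inl b
     else Inr (a, b, smooth_clamp (line_left x0 a b) (line_right x0 a b) t))"
proof (cases "a = b")
  case True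
  then show ?thesis
    using smooth_line_bounds[of x0 a b t] by (simp add: normal_form_def)
next
  case False
  then show ?thesis
    using line_left_less_right[OF False, of x0]
      smooth_clamp_interior[OF line_left_less_right[OF False, of x0]]
    by (cases t)
      (auto simp: normal_form_def smooth_clamp_PInf smooth_clamp_MInf order_less_imp_not_eq
        order_less_imp_not_eq2)
qed

text \<open>This makes the flow well defined. A point with normal form \<open>Inl c\<close> is an
  endpoint and stays fixed under every shift; any other normal form determines the line and, by
  injectivity, the parameter.\<close>

lemma smooth_pt_shift_cong:
  assumes "smooth_pt x0 a b t = smooth_pt x0 a' b' t'"
  shows "smooth_pt x0 a b (ereal r + t) = smooth_pt x0 a' b' (ereal r + t')"
proof -
  let ?s = "\<lambda>a b t. smooth_clamp (line_left x0 a b) (line_right x0 a b) t"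
  have "normal_form x0 (a, b, ?s a b t) = normal_form x0 (a', b', ?s a' b' t')"
    using assms unfolding smooth_pt_def by (intro join_pt_eqD smooth_line_bounds)
  then have nf: "(if a = b \<or> t = -\<infinity> then Inl a else if t = \<infinity> then Inl b else Inr (a, b, ?s a b t)) =
     (if a' = b' \<or> t' = -\<infinity> then Inl a' else if t' = \<infinity> then Inl b' else Inr (a', b', ?s a' b' t'))"
    by (simp only: normal_form_smooth)
  have inl: "smooth_pt x0 a b (ereal r + t) = join_pt x0 c c 0"
    if "(if a = b \<or> t = -\<infinity> then Inl a else if t = \<infinity> then Inl b else Inr (a, b, ?s a b t)) = Inl c"
    for a b c t
    using that by (auto simp: smooth_pt_refl smooth_pt_PInf smooth_pt_MInf split: if_splits)
  show ?thesis
  proof (cases "a = b \<or> t = -\<infinity> \<or> t = \<infinity>")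
    case True
    then obtain c where
      "(if a = b \<or> t = -\<infinity> then Inl a else if t = \<infinity> then Inl b else Inr (a, b, ?s a b t)) = Inl c"
      by auto
    then show ?thesis
      using inl[of a b t c] inl[of a' b' t' c] nf by simp
  next
    case False
    then have "a = a'" "b = b'" "?s a b t = ?s a' b' t'"
      using nf by (auto split: if_splits)
    moreover from this have "t = t'"
      using False smooth_clamp_inj[OF line_left_less_right] by blast
    ultimately show ?thesis
      by simp
  qed
qed

lemma flow_smooth_pt: "flow x0 r (smooth_pt x0 a b t) = smooth_pt x0 a b (ereal r + t)"
proof -
  have "{smooth_pt x0 a' b' (ereal r + t') | a' b' t'. smooth_pt x0 a b t = smooth_pt x0 a' b' t'} =
      {smooth_pt x0 a b (ereal r + t)}"
    using smooth_pt_shift_cong by blast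
  then show ?thesis
    by (simp add: flow_def)
qed

lemma flow_smooth_pt_real: "flow x0 r (smooth_pt x0 a b (ereal t)) = smooth_pt x0 a b (ereal (r + t))"
  by (simp add: flow_smooth_pt)

lemma flow_in_sym_join: "x \<in> sym_join x0 \<Longrightarrow> flow x0 r x \<in> sym_join x0"
  by (auto elim!: sym_join_smooth_cases simp: flow_smooth_pt smooth_pt_in_sym_join)

section \<open>The pseudometric\<close>

lemma ell_smooth_pt:
  "ell x0 u (smooth_pt x0 a b t) = gromov_prod a b u +
    \<bar>smooth_clamp (line_left x0 a b) (line_right x0 a b) t - double_diff a b u x0\<bar>"
  unfolding smooth_pt_def by (intro ell_join_pt smooth_line_bounds)

text \<open>At the left end the value is \<open>dist a u\<close>, and along the line it changes by
  at most the length. The estimate is uniform in u, which makes the supremum in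
  \<open>dist_cross\<close> finite.\<close>

lemma ell_near:
  assumes "line_left x0 a b \<le> s" "s \<le> line_right x0 a b"
  shows "\<bar>ell x0 u (join_pt x0 a b s) - dist a u\<bar> \<le> dist a b"
  using assms dist_triangle[of a b u] dist_triangle[of b u a] dist_triangle[of a u b]
  unfolding ell_join_pt[OF assms]
  by (auto simp: products dist_commute abs_if field_simps split: if_splits)

text \<open>The bound depends only on the two lines, not on u or on the parameters; since the flow
  preserves lines, it serves for all times at once.\<close>

lemma busemann_cross_le:
  "\<bar>busemann_cross x0 u (smooth_pt x0 a b t) (smooth_pt x0 a' b' t')\<bar> \<le> dist a a' + dist a b + dist a' b'"
proof -
  have "\<bar>ell x0 u (smooth_pt x0 a b t) - dist a u\<bar> \<le> dist a b"
    "\<bar>ell x0 u (smooth_pt x0 a' b' t') - dist a' u\<bar> \<le> dist a' b'"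
    unfolding smooth_pt_def by (intro ell_near smooth_line_bounds)+
  moreover have "\<bar>dist a u - dist a' u\<bar> \<le> dist a a'"
    using abs_dist_diff_le[of a u a'] by (simp add: dist_commute)
  ultimately show ?thesis
    unfolding busemann_cross_def by linarith
qed

lemma bdd_above_busemann_cross:
  assumes "x \<in> sym_join x0" "y \<in> sym_join x0"
  shows "bdd_above (range (\<lambda>u. \<bar>busemann_cross x0 u x y\<bar>))"
proof -
  obtain a b t a' b' t' where "x = smooth_pt x0 a b (ereal t)" "y = smooth_pt x0 a' b' (ereal t')"
    using assms by (elim sym_join_smooth_cases)
  then show ?thesis
    using busemann_cross_le by (intro bdd_aboveI2) blast
qed

lemma busemann_cross_le_dist_cross:
  "x \<in> sym_join x0 \<Longrightarrow> y \<in> sym_join x0 \<Longrightarrow> \<bar>busemann_cross x0 u x y\<bar> \<le> dist_cross x0 x y"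
  unfolding dist_cross_def by (rule cSUP_upper[OF UNIV_I bdd_above_busemann_cross])

lemma dist_cross_le: "(\<And>u. \<bar>busemann_cross x0 u x y\<bar> \<le> C) \<Longrightarrow> dist_cross x0 x y \<le> C"
  unfolding dist_cross_def by (rule cSUP_least) auto

lemma dist_cross_nonneg:
  assumes "x \<in> sym_join x0" "y \<in> sym_join x0"
  shows "0 \<le> dist_cross x0 x y"
  \<comment> \<open>Any point u will do; \<open>undefined\<close> is an arbitrary element of the
    type.\<close>
  using busemann_cross_le_dist_cross[OF assms, of undefined] by linarith

lemma dist_cross_commute: "dist_cross x0 x y = dist_cross x0 y x"
  by (simp add: dist_cross_def busemann_cross_def abs_minus_commute)

lemma dist_cross_triangle:
  assumes "x \<in> sym_join x0" "y \<in> sym_join x0" "z \<in> sym_join x0"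
  shows "dist_cross x0 x z \<le> dist_cross x0 x y + dist_cross x0 y z"
proof (rule dist_cross_le)
  fix u
  show "\<bar>busemann_cross x0 u x z\<bar> \<le> dist_cross x0 x y + dist_cross x0 y z"
    using busemann_cross_le_dist_cross[OF assms(1,2), of u] busemann_cross_le_dist_cross[OF assms(2,3), of u]
    unfolding busemann_cross_def by linarith
qed

text \<open>On a common line the Gromov products cancel, and what remains is at most the difference
  of the coordinates.\<close>

lemma dist_cross_smooth_lipschitz:
  "dist_cross x0 (smooth_pt x0 a b (ereal t)) (smooth_pt x0 a b (ereal t')) \<le> \<bar>t - t'\<bar>"
proof (rule dist_cross_le)
  fix u
  show "\<bar>busemann_cross x0 u (smooth_pt x0 a b (ereal t)) (smooth_pt x0 a b (ereal t'))\<bar> \<le> \<bar>t - t'\<bar>"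
    using smooth_clamp_lipschitz[of "line_left x0 a b" "line_right x0 a b" t t']
    unfolding busemann_cross_def ell_smooth_pt by linarith
qed

lemma dist_cross_flow_lipschitz:
  assumes "x \<in> sym_join x0"
  shows "dist_cross x0 (flow x0 r x) (flow x0 r' x) \<le> \<bar>r - r'\<bar>"
proof -
  obtain a b t where "x = smooth_pt x0 a b (ereal t)"
    using assms by (rule sym_join_smooth_cases)
  then show ?thesis
    using dist_cross_smooth_lipschitz[of x0 a b "r + t" "r' + t"] by (simp add: flow_smooth_pt)
qed

text \<open>By the triangle inequality, changing the time from r to r' costs |r - r'| for each of
  the two points, hence the Lipschitz constant 2.\<close>

lemma continuous_dist_cross_flow:
  assumes x: "x \<in> sym_join x0" and y: "y \<in> sym_join x0"
  shows "continuous_on UNIV (\<lambda>r. dist_cross x0 (flow x0 r x) (flow x0 r y))"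
proof (rule lipschitz_on_continuous_on[where L = 2])
  let ?f = "\<lambda>r. dist_cross x0 (flow x0 r x) (flow x0 r y)"
  have le: "?f r \<le> ?f r' + 2 * \<bar>r - r'\<bar>" for r r'
  proof -
    note J = flow_in_sym_join[OF x] flow_in_sym_join[OF y]
    have "?f r \<le> dist_cross x0 (flow x0 r x) (flow x0 r' x) + (?f r' + dist_cross x0 (flow x0 r' y) (flow x0 r y))"
      by (meson J dist_cross_triangle add_left_mono order_trans)
    also have "\<dots> \<le> \<bar>r - r'\<bar> + (?f r' + \<bar>r' - r\<bar>)"
      by (intro add_mono order_refl dist_cross_flow_lipschitz x y)
    finally show ?thesis
      by (simp add: abs_minus_commute)
  qed
  show "2-lipschitz_on UNIV ?f"
  proof (rule lipschitz_onI)
    show "dist (?f r) (?f r') \<le> 2 * dist r r'" for r r'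
      using le[of r r'] le[of r' r] unfolding dist_real_def by (intro abs_leI) (simp_all add: abs_minus_commute)
  qed simp
qed

lemma integrable_dist_cross_flow:
  assumes x: "x \<in> sym_join x0" and y: "y \<in> sym_join x0"
  shows "integrable lborel (\<lambda>r. dist_cross x0 (flow x0 r x) (flow x0 r y) * laplace r)"
proof -
  obtain a b t where x': "x = smooth_pt x0 a b (ereal t)"
    using x by (rule sym_join_smooth_cases)
  obtain a' b' t' where y': "y = smooth_pt x0 a' b' (ereal t')"
    using y by (rule sym_join_smooth_cases)
  show ?thesis
  proof (rule integrable_bounded_laplace)
    show "(\<lambda>r. dist_cross x0 (flow x0 r x) (flow x0 r y)) \<in> borel_measurable borel"
      using continuous_dist_cross_flow[OF x y] by (rule borel_measurable_continuous_onI)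
    show "\<bar>dist_cross x0 (flow x0 r x) (flow x0 r y)\<bar> \<le> dist a a' + dist a b + dist a' b'" for r
      using dist_cross_nonneg[OF flow_in_sym_join[OF x, of r] flow_in_sym_join[OF y, of r]]
      unfolding x' y' flow_smooth_pt by (simp add: dist_cross_le[OF busemann_cross_le])
  qed
qed

section \<open>The metric\<close>

lemma ell_flow_at_bot: "(\<lambda>n. ell x0 u (flow x0 (- real n) (smooth_pt x0 a b (ereal t)))) \<longlonglongrightarrow> dist a u"
proof -
  have "(\<lambda>n. ell x0 u (flow x0 (- real n) (smooth_pt x0 a b (ereal t)))) \<longlonglongrightarrow>
      gromov_prod a b u + \<bar>line_left x0 a b - double_diff a b u x0\<bar>"
    unfolding flow_smooth_pt_real ell_smooth_pt
    by (intro tendsto_intros smooth_clamp_at_bot line_left_le_right)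
  \<comment> \<open>At the left end the absolute value equals \<open>gromov_prod b u a\<close>,
    nonnegative by the triangle inequality, and the two Gromov products add up to
    \<open>dist a u\<close>.\<close>
  also have "gromov_prod a b u + \<bar>line_left x0 a b - double_diff a b u x0\<bar> = dist a u"
    using dist_triangle[of b u a] by (simp add: products dist_commute field_simps)
  finally show ?thesis .
qed

lemma ell_flow_at_top: "(\<lambda>n. ell x0 u (flow x0 (real n) (smooth_pt x0 a b (ereal t)))) \<longlonglongrightarrow> dist b u"
proof -
  have "(\<lambda>n. ell x0 u (flow x0 (real n) (smooth_pt x0 a b (ereal t)))) \<longlonglongrightarrow>
      gromov_prod a b u + \<bar>line_right x0 a b - double_diff a b u x0\<bar>"
    unfolding flow_smooth_pt_real ell_smooth_pt
    by (intro tendsto_intros smooth_clamp_at_top line_left_le_right)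
  also have "gromov_prod a b u + \<bar>line_right x0 a b - double_diff a b u x0\<bar> = dist b u"
    using dist_triangle[of a u b] by (simp add: products dist_commute field_simps)
  finally show ?thesis .
qed

lemma dist_cross_flow_eq_0_imp_eq:
  assumes x: "x \<in> sym_join x0" and y: "y \<in> sym_join x0"
    and 0: "\<And>r. dist_cross x0 (flow x0 r x) (flow x0 r y) = 0"
  shows "x = y"
proof -
  have eq: "ell x0 u (flow x0 r x) = ell x0 u (flow x0 r y)" for u r
    using busemann_cross_le_dist_cross[OF flow_in_sym_join[OF x] flow_in_sym_join[OF y], of u r r] 0[of r]
    by (simp add: busemann_cross_def)
  obtain a b t where x': "x = smooth_pt x0 a b (ereal t)"
    using x by (rule sym_join_smooth_cases)
  obtain a' b' t' where y': "y = smooth_pt x0 a' b' (ereal t')"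
    using y by (rule sym_join_smooth_cases)
  have "dist a u = dist a' u" for u
    using ell_flow_at_bot[of x0 u a b t] ell_flow_at_bot[of x0 u a' b' t'] eq[of u]
    unfolding x' y' by (simp add: LIMSEQ_unique)
  \<comment> \<open>At u = a the left side is 0, so a' has distance 0 from a.\<close>
  from this[of a] have a: "a' = a"
    by simp
  have "dist b u = dist b' u" for u
    using ell_flow_at_top[of x0 u a b t] ell_flow_at_top[of x0 u a' b' t'] eq[of u]
    unfolding x' y' by (simp add: LIMSEQ_unique)
  from this[of b] have b: "b' = b"
    by simp
  \<comment> \<open>Seen from u = a, the minimum of \<open>ell\<close> on the line sits at its left
    end, so the absolute value opens with a fixed sign.\<close>
  have "gromov_prod a b a = 0" "double_diff a b a x0 = line_left x0 a b"
    by (simp_all add: products dist_commute field_simps)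
  then have "ell x0 a (smooth_pt x0 a b s) =
      smooth_clamp (line_left x0 a b) (line_right x0 a b) s - line_left x0 a b" for s
    using smooth_line_bounds(1)[of x0 a b s] unfolding ell_smooth_pt by simp
  then have "smooth_clamp (line_left x0 a b) (line_right x0 a b) (ereal t) =
      smooth_clamp (line_left x0 a b) (line_right x0 a b) (ereal t')"
    using eq[of a 0] by (simp add: x' y' a b flow_smooth_pt)
  then show ?thesis
    by (simp add: x' y' a b smooth_pt_def)
qed

section \<open>The metric axioms\<close>

lemma dist_star_eq:
  "x \<in> sym_join x0 \<Longrightarrow> y \<in> sym_join x0 \<Longrightarrow>
    dist_star x0 x y = (\<integral>r. dist_cross x0 (flow x0 r x) (flow x0 r y) * laplace r \<partial>lborel)"
  by (simp add: dist_star_def)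

lemma Metric_space_dist_star: "Metric_space (sym_join x0) (dist_star x0)"
proof
  have nonneg: "0 \<le> dist_cross x0 (flow x0 r x) (flow x0 r y)"
    if "x \<in> sym_join x0" "y \<in> sym_join x0" for x y r
    using that by (intro dist_cross_nonneg flow_in_sym_join)
  show "0 \<le> dist_star x0 x y" for x y
    using nonneg[of x y] by (simp add: dist_star_def)
  show "dist_star x0 x y = dist_star x0 y x" for x y
    by (simp add: dist_star_def conj_commute dist_cross_commute[of x0 "flow x0 r x" for r])
  show "dist_star x0 x y = 0 \<longleftrightarrow> x = y" if x: "x \<in> sym_join x0" and y: "y \<in> sym_join x0" for x y
  proof
    assume "dist_star x0 x y = 0"
    then have "(\<integral>r. dist_cross x0 (flow x0 r x) (flow x0 r y) * laplace r \<partial>lborel) = 0"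
      by (simp only: dist_star_eq[OF x y])
    then have "dist_cross x0 (flow x0 r x) (flow x0 r y) = 0" for r
      by (rule integral_laplace_eq_0_imp[OF continuous_dist_cross_flow[OF x y] nonneg[OF x y]
          integrable_dist_cross_flow[OF x y]])
    then show "x = y"
      by (rule dist_cross_flow_eq_0_imp_eq[OF x y])
  next
    assume "x = y"
    then show "dist_star x0 x y = 0"
      by (simp add: dist_star_def dist_cross_def busemann_cross_def)
  qed
  show "dist_star x0 x z \<le> dist_star x0 x y + dist_star x0 y z"
    if x: "x \<in> sym_join x0" and y: "y \<in> sym_join x0" and z: "z \<in> sym_join x0" for x y z
  proof -
    note i = integrable_dist_cross_flow
    \<comment> \<open>The triangle inequality of the pseudometric holds at every time r and is
      integrated.\<close>
    have "dist_star x0 x z \<le> (\<integral>r. (dist_cross x0 (flow x0 r x) (flow x0 r y) +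
        dist_cross x0 (flow x0 r y) (flow x0 r z)) * laplace r \<partial>lborel)"
      unfolding dist_star_eq[OF x z]
    proof (rule integral_laplace_mono[OF i[OF x z]])
      show "integrable lborel (\<lambda>r. (dist_cross x0 (flow x0 r x) (flow x0 r y) +
          dist_cross x0 (flow x0 r y) (flow x0 r z)) * laplace r)"
        using Bochner_Integration.integrable_add[OF i[OF x y] i[OF y z]] by (simp only: distrib_right)
    qed (intro dist_cross_triangle flow_in_sym_join x y z)
    also have "\<dots> = dist_star x0 x y + dist_star x0 y z"
      unfolding distrib_right Bochner_Integration.integral_add[OF i[OF x y] i[OF y z]]
      by (simp only: dist_star_eq x y z)
    finally show ?thesis .
  qed
qed

section \<open>Invariance\<close>

text \<open>Covers the action of isometries (\<open>x1 = x0\<close>) and the change of the basepoint (\<open>g = id\<close>) at once.\<close>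

lemma dist_star_transport:
  fixes x0 x1 :: "'a::metric_space"
  assumes g: "g \<in> Isom"
    and \<phi>: "\<And>a b s. line_left x1 a b \<le> s \<Longrightarrow> s \<le> line_right x1 a b \<Longrightarrow>
      \<phi> (join_pt x1 a b s) = join_pt x0 (g a) (g b) (s + double_diff a b x1 (inv g x0))"
    and x: "x \<in> sym_join x1" and y: "y \<in> sym_join x1"
  shows "dist_star x0 (\<phi> x) (\<phi> y) = dist_star x1 x y"
proof -
  have d: "dist (g a) (g b) = dist a b" for a b
    using g by (simp add: Isom_def)
  have surj: "surj g"
    using g by (simp add: Isom_def bij_is_surj)
  have d': "dist (g a) x0 = dist a (inv g x0)" for a
    using d[of a "inv g x0"] surj by (simp add: surj_f_inv_f)
  \<comment> \<open>Both ends move by the same amount, so \<phi> maps each line onto its image line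
    by a translation of coordinates.\<close>
  have ends: "line_left x0 (g a) (g b) = line_left x1 a b + double_diff a b x1 (inv g x0)"
    "line_right x0 (g a) (g b) = line_right x1 a b + double_diff a b x1 (inv g x0)" for a b
    using d'[of a] d'[of b] by (simp_all add: products d dist_commute field_simps)
  have \<phi>_smooth: "\<phi> (smooth_pt x1 a b (ereal t)) =
      smooth_pt x0 (g a) (g b) (ereal (t + double_diff a b x1 (inv g x0)))" for a b t
    using \<phi>[OF smooth_line_bounds] by (simp only: smooth_pt_def ends smooth_clamp_translate)
  have \<phi>_in: "\<phi> z \<in> sym_join x0" and \<phi>_flow: "\<phi> (flow x1 r z) = flow x0 r (\<phi> z)"
    and \<phi>_ell: "ell x0 (g u) (\<phi> z) = ell x1 u z"
    if z: "z \<in> sym_join x1" for z r u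
  proof -
    obtain a b t where z: "z = smooth_pt x1 a b (ereal t)"
      using z by (rule sym_join_smooth_cases)
    show "\<phi> z \<in> sym_join x0"
      by (simp add: z \<phi>_smooth smooth_pt_in_sym_join)
    show "\<phi> (flow x1 r z) = flow x0 r (\<phi> z)"
      by (simp only: z flow_smooth_pt_real \<phi>_smooth add.assoc)
    \<comment> \<open>Additivity of \<open>double_diff\<close> in its last two arguments: the
      coordinate of the point and the centre of the absolute value shift by the same amount.\<close>
    have "double_diff (g a) (g b) (g u) x0 = double_diff a b u x1 + double_diff a b x1 (inv g x0)"
      "gromov_prod (g a) (g b) (g u) = gromov_prod a b u"
      using d'[of a] d'[of b] by (simp_all add: products d dist_commute field_simps)
    then show "ell x0 (g u) (\<phi> z) = ell x1 u z"
      by (simp add: z \<phi>_smooth ell_smooth_pt ends smooth_clamp_translate del: plus_ereal.simps)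
  qed
  have cross: "dist_cross x0 (\<phi> z) (\<phi> w) = dist_cross x1 z w"
    if z: "z \<in> sym_join x1" and w: "w \<in> sym_join x1" for z w
  proof -
    \<comment> \<open>As u runs through the space, so does g u; the suprema are over the same set of
      values.\<close>
    have "(\<lambda>u. \<bar>busemann_cross x0 u (\<phi> z) (\<phi> w)\<bar>) ` range g = range (\<lambda>u. \<bar>busemann_cross x1 u z w\<bar>)"
      by (simp add: image_image busemann_cross_def \<phi>_ell z w)
    then show ?thesis
      by (simp add: dist_cross_def surj)
  qed
  show ?thesis
    by (simp add: dist_star_eq \<phi>_in x y cross flow_in_sym_join flip: \<phi>_flow)
qed

lemma id_Isom: "id \<in> Isom"
  by (simp add: Isom_def)

text \<open>Suprema and integrals are total functions in HOL, so the first conjunct states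
  well-definedness explicitly, through boundedness and integrability. Independence of the basepoint
  means that the canonical identification \<open>change_base\<close> of the joins preserves the
  metrics.\<close>

theorem theorem14:
  fixes x0 :: "'a::metric_space"
  shows
    "(\<forall>x\<in>sym_join x0. \<forall>y\<in>sym_join x0.
        (\<forall>r. flow x0 r x \<in> sym_join x0 \<and> flow x0 r y \<in> sym_join x0 \<and>
             bdd_above (range (\<lambda>u. \<bar>busemann_cross x0 u (flow x0 r x) (flow x0 r y)\<bar>))) \<and>
        integrable lborel
          (\<lambda>r. dist_cross x0 (flow x0 r x) (flow x0 r y) * (exp (- \<bar>r\<bar>) / 2))) \<and>
     Metric_space (sym_join x0) (dist_star x0) \<and>
     (\<forall>g\<in>Isom. \<forall>x\<in>sym_join x0. \<forall>y\<in>sym_join x0.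
        dist_star x0 (isom_act x0 g x) (isom_act x0 g y) = dist_star x0 x y) \<and>
     (\<forall>x1. \<forall>x\<in>sym_join x1. \<forall>y\<in>sym_join x1.
        dist_star x0 (change_base x1 x0 x) (change_base x1 x0 y) = dist_star x1 x y)"
proof (intro conjI ballI allI)
  fix x y r assume "x \<in> sym_join x0" "y \<in> sym_join x0"
  then show "flow x0 r x \<in> sym_join x0" "flow x0 r y \<in> sym_join x0"
    "bdd_above (range (\<lambda>u. \<bar>busemann_cross x0 u (flow x0 r x) (flow x0 r y)\<bar>))"
    "integrable lborel (\<lambda>r. dist_cross x0 (flow x0 r x) (flow x0 r y) * laplace r)"
    by (simp_all only: bdd_above_busemann_cross flow_in_sym_join integrable_dist_cross_flow)
next
  show "Metric_space (sym_join x0) (dist_star x0)"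
    by (rule Metric_space_dist_star)
next
  fix g :: "'a \<Rightarrow> 'a" and x y
  assume "g \<in> Isom" "x \<in> sym_join x0" "y \<in> sym_join x0"
  then show "dist_star x0 (isom_act x0 g x) (isom_act x0 g y) = dist_star x0 x y"
    using dist_star_transport[where g = g and \<phi> = "isom_act x0 g" and ?x0.0 = x0 and ?x1.0 = x0]
    by (simp add: isom_act_join_pt)
next
  fix x1 :: 'a and x y
  assume "x \<in> sym_join x1" "y \<in> sym_join x1"
  \<comment> \<open>For g the identity, \<open>inv g x0\<close> is x0, and the coordinate shift in
    the transport lemma becomes that of \<open>change_base\<close>.\<close>
  then show "dist_star x0 (change_base x1 x0 x) (change_base x1 x0 y) = dist_star x1 x y"
    using dist_star_transport[OF id_Isom, where \<phi> = "change_base x1 x0" and ?x0.0 = x0 and ?x1.0 = x1]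
    by (simp add: change_base_join_pt)
qed

end
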